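(* Let $X$ and $Y$ be irreducible SFTs, let $\varpi:Y\to X$ be a Galois factor, and let $(Z_1,\alpha_1,\beta_1)$ and $(Z_2,\alpha_2,\beta_2)$ be unramified intermediate factors of $\varpi$. Set $H_1=\mathrm{Aut}(Y/Z_1,\alpha_1)$ and $H_2=\mathrm{Aut}(Y/Z_2,\alpha_2)$. Then the following are equivalent: (1) $H_1\subseteq H_2$; (2) there exists an unramified factor map $\gamma:Z_1\to Z_2$ such that $(Z_1,\alpha_1,\gamma)$ is an unramified intermediate factor of $\alpha_2:Y\to Z_2$.
   Context: A shift space over a finite alphabet $\mathcal{A}$ is a nonempty closed shift-invariant subset $X\subseteq\mathcal{A}^{\mathbb{Z}}$ (product topology), with shift map $\sigma_X$. It is a shift of finite type (SFT) if it is defined by a finite set of forbidden words, and irreducible if for all words $u,v$ occurring in points of $X$ there is a nonempty word $w$ with $uwv$ occurring in a point of $X$. A sliding block code is a continuous shift-commuting map; a factor map is a surjective one; a topological conjugacy is a bijective one; $\mathrm{Aut}(X)$ is the group of topological conjugacies $X\to X$. For irreducible SFTs $X,Y$, a factor map $\varpi:Y\to X$ is unramified if there is an integer $d\ge1$ with $|\varpi^{-1}(x)|=d$ for all $x\in X$; $\deg(\varpi)=d$. Put $\mathrm{Aut}(Y/X,\varpi)=\{\varphi\in\mathrm{Aut}(Y)\mid\varpi\circ\varphi=\varpi\}$. The map $\varpi$ is a Galois factor if it is unramified and $|\mathrm{Aut}(Y/X,\varpi)|=\deg(\varpi)$; then $\mathrm{Gal}(Y/X,\varpi):=\mathrm{Aut}(Y/X,\varpi)$.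 An unramified intermediate factor of an unramified factor map $\varpi:Y\to X$ is a triple $(Z,\alpha,\beta)$ with $Z$ an irreducible SFT, $\alpha:Y\to Z$ an unramified factor map and $\beta:Z\to X$ a sliding block code (automatically an unramified factor map) such that $\beta\circ\alpha=\varpi$. *)

theory Defs
  imports "HOL-Analysis.Analysis"
begin

text \<open>Points of the full shift over a finite alphabet \<open>'a\<close> are functions \<open>int \<Rightarrow> 'a\<close>.\<close>

definition full_shift_topology :: "(int \<Rightarrow> 'a) topology" where
  "full_shift_topology = product_topology (\<lambda>_. discrete_topology UNIV) UNIV"

definition shift :: "(int \<Rightarrow> 'a) \<Rightarrow> (int \<Rightarrow> 'a)" where
  "shift x = (\<lambda>i. x (i + 1))"

definition shift_space :: "(int \<Rightarrow> 'a::finite) set \<Rightarrow> bool" where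
  "shift_space X \<longleftrightarrow> X \<noteq> {} \<and> closedin full_shift_topology X \<and> shift ` X = X"

definition occurs_in :: "'a list \<Rightarrow> (int \<Rightarrow> 'a) \<Rightarrow> bool" where
  "occurs_in w x \<longleftrightarrow> (\<exists>i. \<forall>k<length w. x (i + int k) = w ! k)"

definition language :: "(int \<Rightarrow> 'a) set \<Rightarrow> 'a list set" where
  "language X = {w. \<exists>x\<in>X. occurs_in w x}"

definition sft :: "(int \<Rightarrow> 'a::finite) set \<Rightarrow> bool" where
  "sft X \<longleftrightarrow> shift_space X \<and> (\<exists>F. finite F \<and> X = {x. \<forall>w\<in>F. \<not> occurs_in w x})"

definition irreducible_shift :: "(int \<Rightarrow> 'a) set \<Rightarrow> bool" where
  "irreducible_shift X \<longleftrightarrow>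
     (\<forall>u\<in>language X. \<forall>v\<in>language X. \<exists>w. w \<noteq> [] \<and> u @ w @ v \<in> language X)"

definition irreducible_sft :: "(int \<Rightarrow> 'a::finite) set \<Rightarrow> bool" where
  "irreducible_sft X \<longleftrightarrow> sft X \<and> irreducible_shift X"

text \<open>A map between shift spaces is represented by a total function of which only the values
  on the domain matter.\<close>

definition sliding_block_code ::
    "(int \<Rightarrow> 'a::finite) set \<Rightarrow> (int \<Rightarrow> 'b::finite) set \<Rightarrow> ((int \<Rightarrow> 'a) \<Rightarrow> (int \<Rightarrow> 'b)) \<Rightarrow> bool" where
  "sliding_block_code X Y f \<longleftrightarrow>
     continuous_map (subtopology full_shift_topology X) (subtopology full_shift_topology Y) f \<and>
     (\<forall>x\<in>X. f (shift x) = shift (f x))"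

definition factor_map ::
    "(int \<Rightarrow> 'a::finite) set \<Rightarrow> (int \<Rightarrow> 'b::finite) set \<Rightarrow> ((int \<Rightarrow> 'a) \<Rightarrow> (int \<Rightarrow> 'b)) \<Rightarrow> bool" where
  "factor_map Y X f \<longleftrightarrow> sliding_block_code Y X f \<and> f ` Y = X"

definition conjugacy ::
    "(int \<Rightarrow> 'a::finite) set \<Rightarrow> (int \<Rightarrow> 'b::finite) set \<Rightarrow> ((int \<Rightarrow> 'a) \<Rightarrow> (int \<Rightarrow> 'b)) \<Rightarrow> bool" where
  "conjugacy X Y f \<longleftrightarrow> sliding_block_code X Y f \<and> bij_betw f X Y"

text \<open>Extensionality makes each self-conjugacy of \<open>X\<close> correspond to exactly one element of
  \<open>Aut X\<close>; it is needed for cardinalities and inclusions of such sets to be meaningful.\<close>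

definition Aut :: "(int \<Rightarrow> 'a::finite) set \<Rightarrow> ((int \<Rightarrow> 'a) \<Rightarrow> (int \<Rightarrow> 'a)) set" where
  "Aut X = {\<phi> \<in> extensional X. conjugacy X X \<phi>}"

text \<open>The group \<open>Aut(Y/X, p)\<close>; the base \<open>X\<close> is determined as the image of \<open>Y\<close> under \<open>p\<close>.\<close>

definition Aut_over ::
    "(int \<Rightarrow> 'a::finite) set \<Rightarrow> ((int \<Rightarrow> 'a) \<Rightarrow> (int \<Rightarrow> 'b::finite)) \<Rightarrow> ((int \<Rightarrow> 'a) \<Rightarrow> (int \<Rightarrow> 'a)) set" where
  "Aut_over Y p = {\<phi> \<in> Aut Y. \<forall>y\<in>Y. p (\<phi> y) = p y}"

text \<open>Since \<open>d \<ge> 1\<close>, the condition \<open>card \<dots> = d\<close> forces the fibres to be finite.\<close>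

definition unramified ::
    "(int \<Rightarrow> 'a::finite) set \<Rightarrow> (int \<Rightarrow> 'b::finite) set \<Rightarrow> ((int \<Rightarrow> 'a) \<Rightarrow> (int \<Rightarrow> 'b)) \<Rightarrow> bool" where
  "unramified Y X p \<longleftrightarrow>
     factor_map Y X p \<and> (\<exists>d\<ge>1. \<forall>x\<in>X. card {y \<in> Y. p y = x} = d)"

definition deg ::
    "(int \<Rightarrow> 'a::finite) set \<Rightarrow> (int \<Rightarrow> 'b::finite) set \<Rightarrow> ((int \<Rightarrow> 'a) \<Rightarrow> (int \<Rightarrow> 'b)) \<Rightarrow> nat" where
  "deg Y X p = (THE d. \<forall>x\<in>X. card {y \<in> Y. p y = x} = d)"

definition galois_factor ::
    "(int \<Rightarrow> 'a::finite) set \<Rightarrow> (int \<Rightarrow> 'b::finite) set \<Rightarrow> ((int \<Rightarrow> 'a) \<Rightarrow> (int \<Rightarrow> 'b)) \<Rightarrow> bool" where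
  "galois_factor Y X p \<longleftrightarrow> unramified Y X p \<and> card (Aut_over Y p) = deg Y X p"

text \<open>\<open>(Z, \<alpha>, \<beta>)\<close> is an unramified intermediate factor of \<open>p : Y \<rightarrow> X\<close>.\<close>

definition unramified_intermediate_factor ::
    "(int \<Rightarrow> 'a::finite) set \<Rightarrow> (int \<Rightarrow> 'b::finite) set \<Rightarrow> ((int \<Rightarrow> 'a) \<Rightarrow> (int \<Rightarrow> 'b)) \<Rightarrow>
     (int \<Rightarrow> 'c::finite) set \<Rightarrow> ((int \<Rightarrow> 'a) \<Rightarrow> (int \<Rightarrow> 'c)) \<Rightarrow> ((int \<Rightarrow> 'c) \<Rightarrow> (int \<Rightarrow> 'b)) \<Rightarrow> bool" where
  "unramified_intermediate_factor Y X p Z \<alpha> \<beta> \<longleftrightarrow>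
     irreducible_sft Z \<and> unramified Y Z \<alpha> \<and> sliding_block_code Z X \<beta> \<and>
     (\<forall>y\<in>Y. \<beta> (\<alpha> y) = p y)"

end

theory Submission
  imports Defs
begin

text \<open>The heart of the matter is that two distinct points in a common fibre of an unramified map
  \<open>p : Y \<rightarrow> X\<close> already differ on a window \<open>[-m, m]\<close> of uniform size. By Baire's theorem this
  holds, for some window size, over a whole cylinder of \<open>X\<close>. If a point of \<open>X\<close> visits that cylinder far to
  the left and far to the right of \<open>0\<close>, two of its preimages that agree near \<open>0\<close> can be glued there
  to a third preimage, which the cylinder condition identifies with both. Such points are dense by
  irreducibility, and the fibres having constant size, the property passes to limits.

  Consequently two lifts of a map through \<open>p\<close> agree on a clopen invariant set, hence everywhere
  once they agree at a single point. So the Galois group acts simply transitively on fibres, and an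
  element that moves one point within its \<open>\<alpha>1\<close>-fibre lies in \<open>Aut(Y/Z1)\<close>: the fibres of \<open>\<alpha>1\<close> are
  the orbits of \<open>H1\<close>. If \<open>H1 \<subseteq> H2\<close>, then \<open>\<alpha>2\<close> is constant on them and descends to \<open>\<gamma>\<close>.\<close>


section \<open>The topology of shift spaces\<close>

text \<open>Encoded as a restricted function, so that agreement of two points on the window
  \<open>[-n, n]\<close> is a single equation and cylinders are the fibres of
  \<open>central_block n\<close>.\<close>

definition central_block :: "nat \<Rightarrow> (int \<Rightarrow> 'a) \<Rightarrow> (int \<Rightarrow> 'a)" where
  "central_block n x = restrict x {- int n..int n}"

definition shift_by :: "int \<Rightarrow> (int \<Rightarrow> 'a) \<Rightarrow> (int \<Rightarrow> 'a)" where
  "shift_by k x = (\<lambda>i. x (i + k))"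

lemma central_block_eq_iff:
  "central_block n x = central_block n y \<longleftrightarrow> (\<forall>i. \<bar>i\<bar> \<le> int n \<longrightarrow> x i = y i)"
proof -
  have "i \<in> {- int n..int n} \<longleftrightarrow> \<bar>i\<bar> \<le> int n" for i
    by auto
  then show ?thesis
    unfolding central_block_def restrict_def fun_eq_iff by metis
qed

lemma central_block_mono:
  assumes "central_block n x = central_block n y" "m \<le> n"
  shows "central_block m x = central_block m y"
  using assms unfolding central_block_eq_iff by (meson of_nat_mono order_trans)

lemma shift_by_0 [simp]: "shift_by 0 x = x"
  by (simp add: shift_by_def)

lemma shift_by_shift_by [simp]: "shift_by k (shift_by l x) = shift_by (k + l) x"
  by (simp add: shift_by_def add_ac)

lemma shift_eq_shift_by: "shift = shift_by 1"
  by (simp add: shift_def shift_by_def fun_eq_iff)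

lemma shift_by_eq_iff [simp]: "shift_by k x = shift_by k y \<longleftrightarrow> x = y"
  by (metis add.left_inverse shift_by_0 shift_by_shift_by)

lemma topspace_full_shift [simp]: "topspace full_shift_topology = UNIV"
  by (simp add: full_shift_topology_def)

text \<open>A basic open set of the product constrains finitely many coordinates, and these lie in
  some central window; so central cylinders form a neighbourhood base.\<close>

lemma openin_full_shift_iff:
  "openin full_shift_topology U \<longleftrightarrow>
     (\<forall>x\<in>U. \<exists>n. \<forall>y. central_block n y = central_block n x \<longrightarrow> y \<in> U)"
proof
  assume U: "openin full_shift_topology U"
  show "\<forall>x\<in>U. \<exists>n. \<forall>y. central_block n y = central_block n x \<longrightarrow> y \<in> U"
  proof
    fix x assume "x \<in> U"
    then obtain V where V: "finite {i. V i \<noteq> UNIV}" "x \<in> PiE UNIV V" "PiE UNIV V \<subseteq> U"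
      using U unfolding full_shift_topology_def openin_product_topology_alt by auto
    obtain n where n: "\<forall>i\<in>{i. V i \<noteq> UNIV}. nat \<bar>i\<bar> \<le> n"
      using finite_nat_set_iff_bounded_le[of "(\<lambda>i. nat \<bar>i\<bar>) ` {i. V i \<noteq> UNIV}"] V(1) by auto
    have "y \<in> U" if "central_block n y = central_block n x" for y
    proof -
      have "y i \<in> V i" for i
      proof (cases "V i = UNIV")
        case False
        then have "nat \<bar>i\<bar> \<le> n" using n by auto
        then have "y i = x i"
          using that unfolding central_block_eq_iff by (simp add: nat_le_iff)
        then show ?thesis using V(2) by auto
      qed simp
      then show ?thesis using V(3) by auto
    qed
    then show "\<exists>n. \<forall>y. central_block n y = central_block n x \<longrightarrow> y \<in> U" by blast
  qed
next
  assume *: "\<forall>x\<in>U. \<exists>n. \<forall>y. central_block n y = central_block n x \<longrightarrow> y \<in> U"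
  show "openin full_shift_topology U"
    unfolding full_shift_topology_def openin_product_topology_alt
  proof (intro ballI)
    fix x assume "x \<in> U"
    then obtain n where n: "\<And>y. central_block n y = central_block n x \<Longrightarrow> y \<in> U"
      using * by blast
    define V where "V = (\<lambda>i::int. if \<bar>i\<bar> \<le> int n then {x i} else UNIV)"
    have "finite {i. V i \<noteq> UNIV}"
      by (rule finite_subset[of _ "{- int n..int n}"]) (auto simp: V_def split: if_splits)
    moreover have "PiE UNIV V \<subseteq> U"
    proof
      fix y assume "y \<in> PiE UNIV V"
      then have y: "y i \<in> V i" for i by auto
      have "y i = x i" if "\<bar>i\<bar> \<le> int n" for i
        using y[of i] that by (simp add: V_def)
      then show "y \<in> U" by (intro n) (simp add: central_block_eq_iff)
    qed
    moreover have "x \<in> PiE UNIV V" by (auto simp: V_def)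
    ultimately show "\<exists>V. finite {i \<in> UNIV. V i \<noteq> topspace (discrete_topology UNIV)} \<and>
        (\<forall>i\<in>UNIV. openin (discrete_topology UNIV) (V i)) \<and> x \<in> PiE UNIV V \<and> PiE UNIV V \<subseteq> U"
      by (intro exI[of _ V]) simp
  qed
qed

abbreviation shift_topology :: "(int \<Rightarrow> 'a) set \<Rightarrow> (int \<Rightarrow> 'a) topology" where
  "shift_topology X \<equiv> subtopology full_shift_topology X"

lemma openin_shift_topology_iff:
  "openin (shift_topology X) U \<longleftrightarrow> U \<subseteq> X \<and>
     (\<forall>x\<in>U. \<exists>n. \<forall>y\<in>X. central_block n y = central_block n x \<longrightarrow> y \<in> U)"
proof
  assume "openin (shift_topology X) U"
  then show "U \<subseteq> X \<and> (\<forall>x\<in>U. \<exists>n. \<forall>y\<in>X. central_block n y = central_block n x \<longrightarrow> y \<in> U)"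
    unfolding openin_subtopology openin_full_shift_iff by blast
next
  assume *: "U \<subseteq> X \<and> (\<forall>x\<in>U. \<exists>n. \<forall>y\<in>X. central_block n y = central_block n x \<longrightarrow> y \<in> U)"
  then obtain n where n: "\<And>x y. x \<in> U \<Longrightarrow> y \<in> X \<Longrightarrow> central_block (n x) y = central_block (n x) x \<Longrightarrow> y \<in> U"
    by metis
  \<comment> \<open>The window size varies with the point. \<open>V\<close> is the union of the
    chosen cylinders, taken in the full shift, and its trace on \<open>X\<close> is
    \<open>U\<close>.\<close>
  define V where "V = {y. \<exists>x\<in>U. central_block (n x) y = central_block (n x) x}"
  have "openin full_shift_topology V"
    unfolding openin_full_shift_iff V_def
    by (intro ballI, clarsimp) metis
  moreover have "U = V \<inter> X"
    using * n unfolding V_def by blast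
  ultimately show "openin (shift_topology X) U"
    unfolding openin_subtopology by blast
qed

lemma closedin_shift_topology_iff:
  "closedin (shift_topology X) C \<longleftrightarrow> C \<subseteq> X \<and>
     (\<forall>x\<in>X - C. \<exists>n. \<forall>y\<in>X. central_block n y = central_block n x \<longrightarrow> y \<notin> C)"
  unfolding closedin_def openin_shift_topology_iff by auto

lemma shift_space_compact: "shift_space X \<Longrightarrow> compact_space (shift_topology X)"
  unfolding shift_space_def full_shift_topology_def
  by (metis closedin_compact_space compact_space_def compact_space_discrete_topology
      compact_space_product_topology compact_space_subtopology finite)

lemma Hausdorff_shift_topology: "Hausdorff_space (shift_topology X)"
  unfolding full_shift_topology_def
  by (intro Hausdorff_space_subtopology) (simp add: Hausdorff_space_product_topology Hausdorff_space_discrete_topology)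

lemma shift_by_mem:
  assumes "shift_space X" "x \<in> X"
  shows "shift_by k x \<in> X"
proof -
  have X: "shift ` X = X" using assms(1) by (simp add: shift_space_def)
  have pos: "shift_by (int n) x \<in> X" for n
  proof (induction n)
    case (Suc n)
    then have "shift (shift_by (int n) x) \<in> X" using X by blast
    then show ?case by (simp add: shift_eq_shift_by)
  qed (use assms in simp)
  have neg: "shift_by (- int n) x \<in> X" for n
  proof (induction n)
    case (Suc n)
    \<comment> \<open>Backward shifts stay in \<open>X\<close> because \<open>shift\<close> maps
      \<open>X\<close> onto itself.\<close>
    then obtain y where y: "y \<in> X" "shift y = shift_by (- int n) x" using X by force
    then have "shift_by (-1) (shift y) = shift_by (- int (Suc n)) x"
      by (simp add: add.commute)
    then show ?case using y by (simp add: shift_eq_shift_by)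
  qed (use assms in simp)
  show ?thesis
    by (cases k rule: int_cases2) (use pos neg in auto)
qed

section \<open>Sliding block codes\<close>

lemma sbc_mem: "sliding_block_code X Y f \<Longrightarrow> x \<in> X \<Longrightarrow> f x \<in> Y"
  unfolding sliding_block_code_def continuous_map_def by auto

lemma sbc_continuousD:
  assumes "sliding_block_code X Y f" "x \<in> X"
  shows "\<exists>n. \<forall>y\<in>X. central_block n y = central_block n x \<longrightarrow> central_block m (f y) = central_block m (f x)"
proof -
  let ?U = "{u\<in>Y. central_block m u = central_block m (f x)}"
  have "openin (shift_topology Y) ?U"
    unfolding openin_shift_topology_iff by (auto intro!: exI[of _ m])
  then have "openin (shift_topology X) {y \<in> topspace (shift_topology X). f y \<in> ?U}"
    using assms(1) unfolding sliding_block_code_def continuous_map_def by blast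
  moreover have "x \<in> {y \<in> topspace (shift_topology X). f y \<in> ?U}"
    using assms(2) sbc_mem[OF assms] by simp
  ultimately obtain n where n: "\<forall>y\<in>X. central_block n y = central_block n x \<longrightarrow>
      y \<in> {y \<in> topspace (shift_topology X). f y \<in> ?U}"
    unfolding openin_shift_topology_iff by blast
  then show ?thesis by (intro exI[of _ n]) simp
qed

lemma sbc_shift_by:
  assumes "shift_space X" "sliding_block_code X Y f" "x \<in> X"
  shows "f (shift_by k x) = shift_by k (f x)"
proof -
  have f: "f (shift_by 1 u) = shift_by 1 (f u)" if "u \<in> X" for u
    using assms(2) that unfolding sliding_block_code_def by (simp add: shift_eq_shift_by)
  have pos: "f (shift_by (int n) u) = shift_by (int n) (f u)" if "u \<in> X" for n u
  proof (induction n)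
    case (Suc n)
    then show ?case
      using f[OF shift_by_mem[OF assms(1) that, of "int n"]] by simp
  qed simp
  have neg: "f (shift_by (- int n) x) = shift_by (- int n) (f x)" for n
  proof -
    \<comment> \<open>The forward case is applied at the backward shift of \<open>x\<close>, and the
      shift is then cancelled.\<close>
    have "f x = shift_by (int n) (f (shift_by (- int n) x))"
      using pos[OF shift_by_mem[OF assms(1,3), of "- int n"], of n] by simp
    then show ?thesis by simp
  qed
  show ?thesis
    by (cases k rule: int_cases2) (use pos neg assms in auto)
qed

lemma sbc_comp:
  assumes "sliding_block_code X Y f" "sliding_block_code Y Z g"
  shows "sliding_block_code X Z (\<lambda>x. g (f x))"
  using assms sbc_mem[OF assms(1)] continuous_map_compose[of _ _ f _ g]
  unfolding sliding_block_code_def comp_def by metis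

lemma sbc_closed_map:
  assumes "shift_space X" "sliding_block_code X Y f"
  shows "closed_map (shift_topology X) (shift_topology Y) f"
  using assms shift_space_compact Hausdorff_shift_topology continuous_imp_closed_map
  unfolding sliding_block_code_def by blast

text \<open>The Curtis-Hedlund-Lyndon theorem. Continuity gives each point a window that determines
  coordinate 0 of the image, compactness makes the window uniform, and commuting with shifts carries
  it to every coordinate.\<close>

lemma sbc_memory:
  fixes f :: "(int \<Rightarrow> 'a::finite) \<Rightarrow> (int \<Rightarrow> 'b::finite)"
  assumes X: "shift_space X" and f: "sliding_block_code X Y f"
  obtains m :: nat where
    "\<And>x y i. x \<in> X \<Longrightarrow> y \<in> X \<Longrightarrow> (\<And>j. \<bar>j - i\<bar> \<le> int m \<Longrightarrow> x j = y j) \<Longrightarrow> f x i = f y i"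
proof -
  have "\<forall>x\<in>X. \<exists>n. \<forall>y\<in>X. central_block n y = central_block n x \<longrightarrow> f y 0 = f x 0"
    using sbc_continuousD[OF f, where m = 0] by (auto simp: central_block_eq_iff)
  then obtain n where n: "\<And>x y. x \<in> X \<Longrightarrow> y \<in> X \<Longrightarrow> central_block (n x) y = central_block (n x) x \<Longrightarrow> f y 0 = f x 0"
    by metis
  define C where "C x = {y\<in>X. central_block (n x) y = central_block (n x) x}" for x
  have "openin (shift_topology X) (C x)" for x
    unfolding openin_shift_topology_iff C_def by (auto intro!: exI[of _ "n x"])
  moreover have "X \<subseteq> \<Union>(C ` X)" by (auto simp: C_def)
  moreover have "compactin (shift_topology X) X"
    using shift_space_compact[OF X] by (simp add: compact_space_def)
  ultimately obtain \<F> where "finite \<F>" "\<F> \<subseteq> C ` X" "X \<subseteq> \<Union>\<F>"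
    using compactinD[of "shift_topology X" X "C ` X"] by blast
  then obtain K where K: "finite K" "K \<subseteq> X" "X \<subseteq> \<Union>(C ` K)"
    using finite_subset_image[of \<F> C X] by blast
  obtain m where m: "\<forall>k\<in>K. n k \<le> m"
    using finite_nat_set_iff_bounded_le[of "n ` K"] K(1) by auto
  have 0: "f x 0 = f y 0" if "x \<in> X" "y \<in> X" "central_block m x = central_block m y" for x y
  proof -
    obtain k where k: "k \<in> K" "x \<in> C k" using K(3) \<open>x \<in> X\<close> by blast
    then have "central_block (n k) x = central_block (n k) y"
      using m that(3) central_block_mono by blast
    then show ?thesis
      using n[of k x] n[of k y] k K(2) that unfolding C_def by auto
  qed
  have "f x i = f y i" if xy: "x \<in> X" "y \<in> X" "\<And>j. \<bar>j - i\<bar> \<le> int m \<Longrightarrow> x j = y j" for x y i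
  proof -
    have "central_block m (shift_by i x) = central_block m (shift_by i y)"
      using xy(3) by (simp add: central_block_eq_iff shift_by_def)
    then have "f (shift_by i x) 0 = f (shift_by i y) 0"
      using 0 shift_by_mem[OF X] xy by blast
    then show ?thesis
      by (simp add: sbc_shift_by[OF X f] xy) (simp add: shift_by_def)
  qed
  then show ?thesis using that by blast
qed

text \<open>The points of \<open>Y\<close> whose block is absent from the fibre over
  \<open>x\<close> form a closed set. Its image under the closed map \<open>p\<close> is closed and
  misses \<open>x\<close>, hence misses a cylinder around \<open>x\<close>.\<close>

lemma central_blocks_of_fibre_usc:
  assumes Y: "shift_space Y" and p: "sliding_block_code Y X p" and x: "x \<in> X"
  shows "\<exists>n. \<forall>x'\<in>X. central_block n x' = central_block n x \<longrightarrow>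
    central_block m ` {y\<in>Y. p y = x'} \<subseteq> central_block m ` {y\<in>Y. p y = x}"
proof -
  define C where "C = {y\<in>Y. central_block m y \<notin> central_block m ` {y\<in>Y. p y = x}}"
  have "closedin (shift_topology Y) C"
    unfolding closedin_shift_topology_iff C_def by (auto intro!: exI[of _ m])
  then have "closedin (shift_topology X) (p ` C)"
    using sbc_closed_map[OF Y p] by (simp add: closed_map_def)
  moreover have "x \<notin> p ` C" unfolding C_def by auto
  ultimately obtain n where n: "\<forall>x'\<in>X. central_block n x' = central_block n x \<longrightarrow> x' \<notin> p ` C"
    using x unfolding closedin_shift_topology_iff by blast
  then show ?thesis by (intro exI[of _ n]) (auto simp: C_def)
qed

section \<open>Gluing and irreducibility\<close>

definition glue :: "(int \<Rightarrow> 'a) \<Rightarrow> (int \<Rightarrow> 'a) \<Rightarrow> (int \<Rightarrow> 'a)" where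
  "glue x y = (\<lambda>i. if i \<le> 0 then x i else y i)"

text \<open>With \<open>m\<close> bounding the lengths of the forbidden words, every word of length
  at most \<open>m\<close> seen in the glued point is already seen in \<open>x\<close> or in
  \<open>y\<close>.\<close>

lemma sft_glue:
  assumes "sft Y"
  obtains m where "\<And>n x y. m \<le> n \<Longrightarrow> x \<in> Y \<Longrightarrow> y \<in> Y \<Longrightarrow> central_block n x = central_block n y
    \<Longrightarrow> glue x y \<in> Y"
proof -
  obtain F where F: "finite F" "Y = {x. \<forall>w\<in>F. \<not> occurs_in w x}"
    using assms unfolding sft_def by blast
  obtain m where m: "\<forall>w\<in>F. length w \<le> m"
    using finite_nat_set_iff_bounded_le[of "length ` F"] F(1) by auto
  have "glue x y \<in> Y"
    if "m \<le> n" "x \<in> Y" "y \<in> Y" "central_block n x = central_block n y" for n x y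
  proof -
    have xy: "x i = y i" if "\<bar>i\<bar> \<le> int m" for i
      using that central_block_mono[OF \<open>central_block n x = central_block n y\<close> \<open>m \<le> n\<close>]
      by (simp add: central_block_eq_iff)
    have False if w: "w \<in> F" and occ: "occurs_in w (glue x y)" for w
    proof -
      obtain i where i: "\<forall>k<length w. glue x y (i + int k) = w ! k"
        using occ unfolding occurs_in_def by blast
      have len: "length w \<le> m" using m w by blast
      show False
      \<comment> \<open>A word starting left of \<open>-m\<close> ends before 0 and is read from
        \<open>x\<close>. Any other word is read from \<open>y\<close>: where it meets coordinates
        up to 0 it lies in the window on which \<open>x\<close> and \<open>y\<close> agree.\<close>
      proof (cases "i < - int m")
        case True
        then have "\<forall>k<length w. x (i + int k) = w ! k"
          using i len by (auto simp: glue_def)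
        then have "occurs_in w x" unfolding occurs_in_def by blast
        then show False using F(2) w \<open>x \<in> Y\<close> by blast
      next
        case False
        have "y (i + int k) = w ! k" if "k < length w" for k
        proof (cases "i + int k \<le> 0")
          case True
          then have "x (i + int k) = y (i + int k)" using False by (intro xy) auto
          then show ?thesis using i that True by (auto simp: glue_def)
        next
          case False
          then show ?thesis using i that by (auto simp: glue_def)
        qed
        then have "occurs_in w y" unfolding occurs_in_def by blast
        then show False using F(2) w \<open>y \<in> Y\<close> by blast
      qed
    qed
    then show ?thesis using F(2) by blast
  qed
  then show ?thesis using that by blast
qed

text \<open>The window must cover both the forbidden words and the memory of \<open>p\<close>. Then
  each coordinate of the image of the glued point is computed from a stretch that coincides with one
  of \<open>x\<close> or one of \<open>y\<close>, and these have the same image.\<close>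

lemma sft_glue_fibre:
  assumes Y: "sft Y" and p: "sliding_block_code Y X p"
  obtains m where "\<And>x y. x \<in> Y \<Longrightarrow> y \<in> Y \<Longrightarrow> p x = p y \<Longrightarrow> central_block m x = central_block m y
    \<Longrightarrow> glue x y \<in> Y \<and> p (glue x y) = p x"
proof -
  obtain m1 where m1: "\<And>n x y. m1 \<le> n \<Longrightarrow> x \<in> Y \<Longrightarrow> y \<in> Y \<Longrightarrow> central_block n x = central_block n y
    \<Longrightarrow> glue x y \<in> Y"
    using sft_glue[OF Y] by blast
  have "shift_space Y" using Y by (simp add: sft_def)
  then obtain m2 where m2: "\<And>x y i. x \<in> Y \<Longrightarrow> y \<in> Y \<Longrightarrow> (\<And>j. \<bar>j - i\<bar> \<le> int m2 \<Longrightarrow> x j = y j)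
    \<Longrightarrow> p x i = p y i"
    using sbc_memory[OF _ p] by blast
  let ?m = "max m1 m2"
  have "glue x y \<in> Y \<and> p (glue x y) = p x"
    if xy: "x \<in> Y" "y \<in> Y" "p x = p y" "central_block ?m x = central_block ?m y" for x y
  proof -
    have s: "glue x y \<in> Y" using m1[of ?m x y] xy by simp
    have eq: "x i = y i" if "\<bar>i\<bar> \<le> int m2" for i
      using xy(4) that by (simp add: central_block_eq_iff)
    have "p (glue x y) i = p x i" for i
    proof (cases "i \<le> 0")
      case True
      show ?thesis
        using True eq by (intro m2 s xy(1)) (auto simp: glue_def)
    next
      case False
      have "p (glue x y) i = p y i"
        using False eq by (intro m2 s xy(2)) (auto simp: glue_def)
      then show ?thesis using xy(3) by simp
    qed
    then show ?thesis using s by blast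
  qed
  then show ?thesis using that by blast
qed

text \<open>Irreducibility restated for cylinders. The bound on \<open>k\<close> says that the two
  windows are disjoint, the second lying to the right.\<close>

lemma irreducible_two_blocks:
  assumes X: "shift_space X" "irreducible_shift X" and xy: "x \<in> X" "y \<in> X"
  obtains z k where "z \<in> X" "central_block m z = central_block m x"
    "central_block n (shift_by k z) = central_block n y" "k > int m + int n"
proof -
  \<comment> \<open>The word read on \<open>[-n, n]\<close>: its letter with index \<open>j\<close>
    sits at coordinate \<open>j - n\<close>.\<close>
  define W :: "nat \<Rightarrow> (int \<Rightarrow> 'a) \<Rightarrow> 'a list" where
    "W = (\<lambda>n x. map (\<lambda>k. x (int k - int n)) [0..<2 * n + 1])"
  have len: "length (W n x) = 2 * n + 1" for n x by (simp add: W_def)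
  have nth: "W n x ! j = x (int j - int n)" if "j < 2 * n + 1" for n x j
    unfolding W_def using that by (subst nth_map) (auto simp del: upt_Suc)
  have "occurs_in (W n x) x" for n x
    unfolding occurs_in_def by (intro exI[of _ "- int n"]) (simp add: len nth)
  then have "W m x \<in> language X" "W n y \<in> language X"
    unfolding language_def using xy by blast+
  then obtain w where "w \<noteq> []" "W m x @ w @ W n y \<in> language X"
    using X(2) unfolding irreducible_shift_def by blast
  then obtain u i where u: "u \<in> X" and
    i: "\<forall>k<length (W m x @ w @ W n y). u (i + int k) = (W m x @ w @ W n y) ! k"
    unfolding language_def occurs_in_def by blast
  \<comment> \<open>The centre of the first word is moved to 0. From there to the centre of the
    second word are \<open>m\<close> letters, the connecting word, \<open>n\<close> letters and one
    further step, which gives \<open>k\<close>.\<close>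
  define z where "z = shift_by (i + int m) u"
  define k where "k = int m + 1 + int (length w) + int n"
  have "z \<in> X" unfolding z_def by (rule shift_by_mem[OF X(1) u])
  moreover have "central_block m z = central_block m x"
    unfolding central_block_eq_iff
  proof (intro allI impI)
    fix j :: int assume j: "\<bar>j\<bar> \<le> int m"
    define l where "l = nat (j + int m)"
    have l: "int l = j + int m" "l < 2 * m + 1" using j by (auto simp: l_def)
    have "u (i + int l) = W m x ! l"
      using i[rule_format, of l] l(2) by (simp add: len nth_append)
    then show "z j = x j"
      using l by (simp add: nth z_def shift_by_def add_ac)
  qed
  moreover have "central_block n (shift_by k z) = central_block n y"
    unfolding central_block_eq_iff
  proof (intro allI impI)
    fix j :: int assume j: "\<bar>j\<bar> \<le> int n"
    define l where "l = nat (j + int n)"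
    have l: "int l = j + int n" "l < 2 * n + 1" using j by (auto simp: l_def)
    let ?l = "2 * m + 1 + length w + l"
    have "u (i + int ?l) = (W m x @ w @ W n y) ! ?l"
      using i[rule_format, of ?l] l(2) by (simp add: len)
    also have "\<dots> = W n y ! l"
      by (simp add: len nth_append)
    finally have "u (i + int ?l) = y j"
      using l by (simp add: nth)
    moreover have "i + int ?l = j + k + (i + int m)"
      using l(1) by (simp add: k_def)
    ultimately show "shift_by k z j = y j"
      unfolding z_def shift_by_def by metis
  qed
  moreover have "k > int m + int n" by (simp add: k_def)
  ultimately show ?thesis using that by blast
qed

lemma irreducible_surrounded_block:
  assumes X: "shift_space X" "irreducible_shift X" and xy: "x \<in> X" "y \<in> X"
  obtains z k l where "z \<in> X" "central_block m z = central_block m x"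
    "central_block n (shift_by (- k) z) = central_block n y" "k > int m + int n"
    "central_block n (shift_by l z) = central_block n y" "l > int m + int n"
proof -
  obtain u k where u: "u \<in> X" "central_block n u = central_block n y"
      "central_block m (shift_by k u) = central_block m x" "k > int n + int m"
    by (rule irreducible_two_blocks[OF X xy(2,1), where m = n and n = m])
  \<comment> \<open>Seen from the centre of the \<open>x\<close>-block, the \<open>y\<close>-block
    on its left occupies \<open>[-k - n, -k + n]\<close>. The window \<open>?m\<close> contains both
    blocks, so the second application preserves them while adding a \<open>y\<close>-block on the
    right.\<close>
  let ?m = "nat k + n"
  obtain z l where z: "z \<in> X" "central_block ?m z = central_block ?m (shift_by k u)"
      "central_block n (shift_by l z) = central_block n y" "l > int ?m + int n"
    by (rule irreducible_two_blocks[OF X shift_by_mem[OF X(1) u(1)] xy(2), where m = ?m and n = n])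
  have "m \<le> ?m" using u(4) by simp
  then have "central_block m z = central_block m x"
    using central_block_mono[OF z(2)] u(3) by simp
  moreover have "central_block n (shift_by (- k) z) = central_block n u"
    unfolding central_block_eq_iff
  proof (intro allI impI)
    fix j :: int assume j: "\<bar>j\<bar> \<le> int n"
    then have "\<bar>j - k\<bar> \<le> int ?m" using u(4) by simp
    then have "z (j - k) = shift_by k u (j - k)"
      using z(2) unfolding central_block_eq_iff by blast
    then show "shift_by (- k) z j = u j" by (simp add: shift_by_def)
  qed
  moreover have "l > int m + int n" "k > int m + int n" using z(4) u(4) by auto
  ultimately show ?thesis using that z(1,3) u(2) by metis
qed

section \<open>Unramified maps\<close>

lemma unramified_sbc: "unramified Y X p \<Longrightarrow> sliding_block_code Y X p"
  unfolding unramified_def factor_map_def by blast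

lemma unramified_image: "unramified Y X p \<Longrightarrow> p ` Y = X"
  unfolding unramified_def factor_map_def by blast

lemma unramified_card:
  assumes "unramified Y X p"
  shows "\<exists>d\<ge>1. \<forall>x\<in>X. card {y\<in>Y. p y = x} = d \<and> finite {y\<in>Y. p y = x}"
proof -
  obtain d where d: "d \<ge> 1" "\<forall>x\<in>X. card {y\<in>Y. p y = x} = d"
    using assms unfolding unramified_def by blast
  then have "finite {y\<in>Y. p y = x}" if "x \<in> X" for x
    using that by (intro card_ge_0_finite) auto
  then show ?thesis using d by blast
qed

section \<open>Uniform separation of the points of a fibre\<close>

text \<open>A compact Hausdorff space is a Baire space, so one member of a countable closed cover of
  the nonempty space \<open>X\<close> has interior points and thus contains a cylinder.\<close>

lemma Baire_shift_space:
  assumes X: "shift_space X" and closed: "\<And>n::nat. closedin (shift_topology X) (S n)"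
    and cover: "X \<subseteq> (\<Union>n. S n)"
  obtains n m x where "x \<in> X" "\<And>y. y \<in> X \<Longrightarrow> central_block m y = central_block m x \<Longrightarrow> y \<in> S n"
proof -
  have "locally_compact_space (shift_topology X) \<and> regular_space (shift_topology X)"
    using shift_space_compact[OF X] Hausdorff_shift_topology
      compact_imp_locally_compact_space compact_Hausdorff_imp_regular_space by blast
  moreover have "shift_topology X interior_of \<Union>(range S) \<noteq> {}"
  proof -
    have "\<Union>(range S) = topspace (shift_topology X)"
      using cover closed closedin_subset by fastforce
    then show ?thesis
      using X by (metis interior_of_topspace shift_space_def topspace_full_shift
          topspace_subtopology Int_UNIV_left)
  qed
  ultimately have "\<not> (\<forall>n. shift_topology X interior_of S n = {})"
    using Baire_category_alt[of "shift_topology X" "range S"] closed by auto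
  then obtain n where "shift_topology X interior_of S n \<noteq> {}" by blast
  then obtain x where x: "x \<in> shift_topology X interior_of S n" by blast
  have "openin (shift_topology X) (shift_topology X interior_of S n)" by simp
  then obtain m where "\<forall>y\<in>X. central_block m y = central_block m x \<longrightarrow> y \<in> shift_topology X interior_of S n"
      "x \<in> X"
    using x unfolding openin_shift_topology_iff by blast
  then show ?thesis
    using that[of x m n] interior_of_subset[of "shift_topology X" "S n"] by blast
qed

lemma finite_inj_on_central_block:
  assumes "finite A"
  obtains n where "inj_on (central_block n) A"
proof -
  \<comment> \<open>The induction asserts injectivity for all larger windows too, so that the window
    for the old points and those for the new pairs can be merged by a maximum.\<close>
  have "\<exists>n. \<forall>m\<ge>n. inj_on (central_block m) A"
    using assms
  proof (induction A rule: finite_induct)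
    case (insert a A)
    then obtain n where n: "\<forall>m\<ge>n. inj_on (central_block m) A" by blast
    have "\<exists>k. b \<noteq> a \<longrightarrow> central_block k b \<noteq> central_block k a" for b
    proof (cases "b = a")
      case False
      then obtain i where "b i \<noteq> a i" by blast
      then show ?thesis
        by (intro exI[of _ "nat \<bar>i\<bar>"]) (auto simp: central_block_eq_iff)
    qed simp
    then obtain k where k: "\<And>b. b \<noteq> a \<Longrightarrow> central_block (k b) b \<noteq> central_block (k b) a" by metis
    obtain l where l: "\<forall>b\<in>A. k b \<le> l"
      using finite_nat_set_iff_bounded_le[of "k ` A"] insert(1) by auto
    have "inj_on (central_block m) (insert a A)" if "m \<ge> max n l" for m
    proof -
      have "central_block m b \<noteq> central_block m a" if "b \<in> A" for b
        using k[of b] l that insert(2) central_block_mono[of m b a "k b"] \<open>m \<ge> max n l\<close> by fastforce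
      then show ?thesis using n \<open>m \<ge> max n l\<close> by (auto simp: inj_on_def) metis+
    qed
    then show ?case by blast
  qed simp
  then show ?thesis using that by blast
qed

text \<open>The Baire argument supplies a window \<open>n\<close> that works over one cylinder only.
  The uniform window obtained is the gluing window \<open>m\<close>; the window \<open>n\<close>
  serves far from 0, where the cylinder is visited.\<close>

lemma unramified_separated:
  assumes Y: "sft Y" and X: "shift_space X" "irreducible_shift X" and p: "unramified Y X p"
  obtains n where "\<And>y y'. y \<in> Y \<Longrightarrow> y' \<in> Y \<Longrightarrow> p y = p y' \<Longrightarrow>
    central_block n y = central_block n y' \<Longrightarrow> y = y'"
proof -
  have Y': "shift_space Y" using Y by (simp add: sft_def)
  have sbc: "sliding_block_code Y X p" by (rule unramified_sbc[OF p])
  obtain d where d: "\<And>x. x \<in> X \<Longrightarrow> card {y\<in>Y. p y = x} = d"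
    and fin: "\<And>x. x \<in> X \<Longrightarrow> finite {y\<in>Y. p y = x}"
    using unramified_card[OF p] by blast
  define S where "S n = {x\<in>X. inj_on (central_block n) {y\<in>Y. p y = x}}" for n
  \<comment> \<open>Injectivity on a fibre means that the number of its central blocks is \<open>d\<close>, and
    this number is upper semicontinuous.\<close>
  have S_limit: "x \<in> S n" if "x \<in> X" and limit: "\<And>m. \<exists>x'\<in>S n. central_block m x' = central_block m x" for x n
  proof -
    obtain m where m: "\<forall>x'\<in>X. central_block m x' = central_block m x \<longrightarrow>
        central_block n ` {y\<in>Y. p y = x'} \<subseteq> central_block n ` {y\<in>Y. p y = x}"
      using central_blocks_of_fibre_usc[OF Y' sbc \<open>x \<in> X\<close>] by blast
    obtain x' where x': "x' \<in> S n" "central_block m x' = central_block m x" using limit by blast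
    have "d = card (central_block n ` {y\<in>Y. p y = x'})"
      using x'(1) d by (simp add: S_def card_image)
    also have "\<dots> \<le> card (central_block n ` {y\<in>Y. p y = x})"
      using m x' fin[OF \<open>x \<in> X\<close>] by (intro card_mono) (auto simp: S_def)
    finally have "card (central_block n ` {y\<in>Y. p y = x}) = card {y\<in>Y. p y = x}"
      using d[OF \<open>x \<in> X\<close>] card_image_le[OF fin[OF \<open>x \<in> X\<close>], of "central_block n"] by simp
    then show ?thesis
      using fin \<open>x \<in> X\<close> by (simp add: S_def eq_card_imp_inj_on)
  qed
  have "closedin (shift_topology X) (S n)" for n
    unfolding closedin_shift_topology_iff
  proof (intro conjI ballI)
    fix x assume "x \<in> X - S n"
    then show "\<exists>m. \<forall>y\<in>X. central_block m y = central_block m x \<longrightarrow> y \<notin> S n"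
      using S_limit[of x n] by blast
  qed (auto simp: S_def)
  moreover have "X \<subseteq> (\<Union>n. S n)"
  proof
    fix x assume "x \<in> X"
    moreover obtain n where "inj_on (central_block n) {y\<in>Y. p y = x}"
      using finite_inj_on_central_block[OF fin[OF \<open>x \<in> X\<close>]] by blast
    ultimately show "x \<in> (\<Union>n. S n)" by (auto simp: S_def)
  qed
  ultimately obtain n r x0 where x0: "x0 \<in> X"
      "\<And>x. x \<in> X \<Longrightarrow> central_block r x = central_block r x0 \<Longrightarrow> x \<in> S n"
    using Baire_shift_space[OF X(1), of S] by metis
  obtain m where glue_mem: "\<And>x y. x \<in> Y \<Longrightarrow> y \<in> Y \<Longrightarrow> p x = p y \<Longrightarrow>
      central_block m x = central_block m y \<Longrightarrow> glue x y \<in> Y \<and> p (glue x y) = p x"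
    using sft_glue_fibre[OF Y sbc] by blast
  have S_m: "x \<in> S m" if x: "x \<in> X" for x
  proof (rule S_limit[OF x])
    fix k
    \<comment> \<open>Enlarging the window by \<open>n\<close> pushes \<open>-a\<close> and
      \<open>b\<close> so far out that the windows of radius \<open>n\<close> around them lie
      strictly left and strictly right of 0.\<close>
    let ?k = "k + n"
    obtain z a b where z: "z \<in> X" "central_block ?k z = central_block ?k x"
        "central_block r (shift_by (- a) z) = central_block r x0" "a > int ?k + int r"
        "central_block r (shift_by b z) = central_block r x0" "b > int ?k + int r"
      by (rule irreducible_surrounded_block[OF X x x0(1), where m = ?k and n = r])
    \<comment> \<open>Shifted by \<open>c\<close>, the point \<open>z\<close> lies in the good
      cylinder, so agreement near coordinate \<open>c\<close> already identifies two preimages of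
      \<open>z\<close>.\<close>
    have inj: "y = y'" if y: "y \<in> Y" "y' \<in> Y" "p y = z" "p y' = z"
      and eq: "central_block n (shift_by c y) = central_block n (shift_by c y')"
      and c: "c = - a \<or> c = b" for y y' c
    proof -
      have "shift_by c z \<in> S n"
        using x0(2) z(3,5) c shift_by_mem[OF X(1) z(1)] by blast
      moreover have "shift_by c y \<in> Y" "shift_by c y' \<in> Y"
        "p (shift_by c y) = shift_by c z" "p (shift_by c y') = shift_by c z"
        using y sbc_shift_by[OF Y' sbc] shift_by_mem[OF Y'] by auto
      ultimately have "shift_by c y = shift_by c y'"
        using eq unfolding S_def inj_on_def by blast
      then show ?thesis by simp
    qed
    have "y = y'" if y: "y \<in> Y" "y' \<in> Y" "p y = z" "p y' = z"
      and eq: "central_block m y = central_block m y'" for y y'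
    proof -
      \<comment> \<open>The glued point is a third preimage of \<open>z\<close>. It agrees with
        \<open>y\<close> around \<open>-a\<close> and with \<open>y'\<close> around
        \<open>b\<close>, hence equals both.\<close>
      have s: "glue y y' \<in> Y" "p (glue y y') = z" using glue_mem[of y y'] y eq by auto
      have "central_block n (shift_by (- a) y) = central_block n (shift_by (- a) (glue y y'))"
        using z(4) by (auto simp: central_block_eq_iff shift_by_def glue_def)
      then have "y = glue y y'" using inj y s by blast
      moreover have "central_block n (shift_by b y') = central_block n (shift_by b (glue y y'))"
        using z(6) by (auto simp: central_block_eq_iff shift_by_def glue_def)
      then have "y' = glue y y'" using inj y s by blast
      ultimately show ?thesis by simp
    qed
    then have "z \<in> S m" using z(1) by (auto simp: S_def inj_on_def)
    moreover have "central_block k z = central_block k x"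
      using central_block_mono[OF z(2)] by simp
    ultimately show "\<exists>x'\<in>S m. central_block k x' = central_block k x" by blast
  qed
  have "y = y'" if "y \<in> Y" "y' \<in> Y" "p y = p y'" "central_block m y = central_block m y'" for y y'
    using S_m[of "p y'"] that sbc_mem[OF sbc that(2)] unfolding S_def inj_on_def by blast
  then show ?thesis using that by blast
qed

section \<open>Lifts through unramified maps, and degrees of factors\<close>

text \<open>By uniform separation, \<open>f\<close> and \<open>g\<close> agree at a point as soon as
  finite blocks of their values do, which is an open condition. Topological transitivity plays the
  part that connectedness plays for covering spaces.\<close>

lemma unramified_unique_lifting:
  assumes Y: "shift_space Y" "irreducible_shift Y"
    and Z: "sft Z" and X: "shift_space X" "irreducible_shift X" and q: "unramified Z X q"
    and f: "sliding_block_code Y Z f" and g: "sliding_block_code Y Z g"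
    and fg: "\<And>y. y \<in> Y \<Longrightarrow> q (f y) = q (g y)"
    and y0: "y0 \<in> Y" "f y0 = g y0" and y: "y \<in> Y"
  shows "f y = g y"
proof -
  obtain n where n: "\<And>z z'. z \<in> Z \<Longrightarrow> z' \<in> Z \<Longrightarrow> q z = q z' \<Longrightarrow>
      central_block n z = central_block n z' \<Longrightarrow> z = z'"
    using unramified_separated[OF Z X q] by blast
  have eq: "f u = g u" if "u \<in> Y" "central_block n (f u) = central_block n (g u)" for u
    using n[OF sbc_mem[OF f] sbc_mem[OF g] fg] that by blast
  have cont: "\<exists>k. \<forall>v\<in>Y. central_block k v = central_block k u \<longrightarrow>
      central_block n (f v) = central_block n (f u) \<and> central_block n (g v) = central_block n (g u)"
    if "u \<in> Y" for u
  proof -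
    obtain k l where k: "\<forall>v\<in>Y. central_block k v = central_block k u \<longrightarrow> central_block n (f v) = central_block n (f u)"
      and l: "\<forall>v\<in>Y. central_block l v = central_block l u \<longrightarrow> central_block n (g v) = central_block n (g u)"
      using sbc_continuousD[OF f \<open>u \<in> Y\<close>, of n] sbc_continuousD[OF g \<open>u \<in> Y\<close>, of n] by blast
    have "central_block k v = central_block k u" "central_block l v = central_block l u"
      if "central_block (max k l) v = central_block (max k l) u" for v
      using central_block_mono[OF that] by simp_all
    then show ?thesis using k l by blast
  qed
  obtain k where k: "\<forall>v\<in>Y. central_block k v = central_block k y0 \<longrightarrow>
      central_block n (f v) = central_block n (f y0) \<and> central_block n (g v) = central_block n (g y0)"
    using cont[OF y0(1)] by blast
  obtain l where l: "\<forall>v\<in>Y. central_block l v = central_block l y \<longrightarrow>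
      central_block n (f v) = central_block n (f y) \<and> central_block n (g v) = central_block n (g y)"
    using cont[OF y] by blast
  \<comment> \<open>The orbit of \<open>z\<close> passes close to \<open>y0\<close>, where equality
    is known, and then close to \<open>y\<close>. Equality persists along the orbit because
    \<open>f\<close> and \<open>g\<close> commute with shifts.\<close>
  obtain z s where z: "z \<in> Y" "central_block k z = central_block k y0"
      "central_block l (shift_by s z) = central_block l y"
    by (rule irreducible_two_blocks[OF Y y0(1) y, where m = k and n = l])
  have "f z = g z"
    using eq[OF z(1)] k z y0(2) by simp
  then have "f (shift_by s z) = g (shift_by s z)"
    using sbc_shift_by[OF Y(1) f z(1)] sbc_shift_by[OF Y(1) g z(1)] by simp
  then show ?thesis
    using eq[OF y] l z(3) shift_by_mem[OF Y(1) z(1)] by metis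
qed

text \<open>A fibre of \<open>q\<close> is the disjoint union of the \<open>a\<close>-fibres over
  the corresponding fibre of \<open>g\<close>, so degrees multiply and the fibres of
  \<open>g\<close> have constant size.\<close>

lemma unramified_right_factor:
  assumes a: "unramified Y Z a" and q: "unramified Y W q" and g: "sliding_block_code Z W g"
    and eq: "\<And>y. y \<in> Y \<Longrightarrow> g (a y) = q y"
  shows "unramified Z W g"
proof -
  obtain e where e: "e \<ge> 1" "\<And>z. z \<in> Z \<Longrightarrow> card {y\<in>Y. a y = z} = e"
      "\<And>z. z \<in> Z \<Longrightarrow> finite {y\<in>Y. a y = z}"
    using unramified_card[OF a] by blast
  obtain d where d: "d \<ge> 1" "\<And>w. w \<in> W \<Longrightarrow> card {y\<in>Y. q y = w} = d"
      "\<And>w. w \<in> W \<Longrightarrow> finite {y\<in>Y. q y = w}"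
    using unramified_card[OF q] by blast
  have aY: "a ` Y = Z" and qY: "q ` Y = W" using unramified_image a q by blast+
  have "g ` Z = W" using eq unfolding aY[symmetric] qY[symmetric] by (simp add: image_image)
  \<comment> \<open>The degree is \<open>d div e\<close>, an exact quotient. The maximum with 1
    makes positivity immediate, since \<open>d = card {z\<in>Z. g z = w} * e\<close> is obtained
    over a given \<open>w\<close>.\<close>
  moreover have "card {z\<in>Z. g z = w} = max 1 (d div e)" if w: "w \<in> W" for w
  proof -
    have "{z\<in>Z. g z = w} = a ` {y\<in>Y. q y = w}"
      using eq unfolding aY[symmetric] by auto
    then have fin: "finite {z\<in>Z. g z = w}" using d(3)[OF w] by simp
    have "{y\<in>Y. q y = w} = (\<Union>z\<in>{z\<in>Z. g z = w}. {y\<in>Y. a y = z})"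
      using aY by (auto simp: eq[symmetric])
    then have "d = card (\<Union>z\<in>{z\<in>Z. g z = w}. {y\<in>Y. a y = z})"
      using d(2)[OF w] by simp
    also have "\<dots> = (\<Sum>z\<in>{z\<in>Z. g z = w}. card {y\<in>Y. a y = z})"
      using fin e(3) by (intro card_UN_disjoint) auto
    also have "\<dots> = card {z\<in>Z. g z = w} * e"
      using e(2) by simp
    finally have "d = card {z\<in>Z. g z = w} * e" .
    moreover from this have "card {z\<in>Z. g z = w} \<ge> 1"
      using d(1) by (cases "card {z\<in>Z. g z = w}") auto
    ultimately show ?thesis using e(1) by simp
  qed
  moreover have "max 1 (d div e) \<ge> 1" by simp
  ultimately show ?thesis
    using g unfolding unramified_def factor_map_def by blast
qed

section \<open>The Galois group acting on fibres\<close>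

lemma Aut_over_sbc: "\<phi> \<in> Aut_over Y p \<Longrightarrow> sliding_block_code Y Y \<phi>"
  unfolding Aut_over_def Aut_def conjugacy_def by blast

text \<open>Evaluation at \<open>y\<close> maps \<open>Aut_over Y p\<close> into the fibre through
  \<open>y\<close> and is injective by unique lifting. Both sets have \<open>d\<close> elements, so
  every point of the fibre is reached.\<close>

lemma galois_transitive:
  assumes X: "shift_space X" "irreducible_shift X" and Y: "irreducible_sft Y"
    and p: "galois_factor Y X p" and y: "y \<in> Y" "y' \<in> Y" "p y = p y'"
  obtains \<phi> where "\<phi> \<in> Aut_over Y p" "\<phi> y = y'"
proof -
  have Y': "sft Y" "shift_space Y" "irreducible_shift Y"
    using Y by (auto simp: irreducible_sft_def sft_def)
  have unr: "unramified Y X p" using p by (simp add: galois_factor_def)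
  obtain d where d: "d \<ge> 1" "\<And>x. x \<in> X \<Longrightarrow> card {y\<in>Y. p y = x} = d"
      "\<And>x. x \<in> X \<Longrightarrow> finite {y\<in>Y. p y = x}"
    using unramified_card[OF unr] by blast
  have py: "p y \<in> X" using y(1) unramified_image[OF unr] by blast
  \<comment> \<open>The point \<open>p y\<close> shows that \<open>X\<close> is nonempty, which
    makes the number described by \<open>deg\<close> unique.\<close>
  have "deg Y X p = d"
    unfolding deg_def using d(2) py by (intro the_equality) auto
  then have card: "card (Aut_over Y p) = d" using p by (simp add: galois_factor_def)
  let ?F = "{u\<in>Y. p u = p y}"
  have "inj_on (\<lambda>\<phi>. \<phi> y) (Aut_over Y p)"
  proof (rule inj_onI)
    fix \<phi> \<psi> assume *: "\<phi> \<in> Aut_over Y p" "\<psi> \<in> Aut_over Y p" "\<phi> y = \<psi> y"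
    have "\<phi> u = \<psi> u" if "u \<in> Y" for u
      by (rule unramified_unique_lifting[OF Y'(2,3,1) X unr Aut_over_sbc[OF *(1)] Aut_over_sbc[OF *(2)] _ y(1) *(3) that])
        (use * in \<open>auto simp: Aut_over_def\<close>)
    \<comment> \<open>Agreement on \<open>Y\<close> becomes equality of functions because members of
      \<open>Aut Y\<close> are extensional.\<close>
    moreover have "\<phi> \<in> extensional Y" "\<psi> \<in> extensional Y"
      using * by (auto simp: Aut_over_def Aut_def)
    ultimately show "\<phi> = \<psi>" by (meson extensionalityI)
  qed
  then have "card ((\<lambda>\<phi>. \<phi> y) ` Aut_over Y p) = card ?F"
    using d(2)[OF py] card by (simp add: card_image)
  moreover have "(\<lambda>\<phi>. \<phi> y) ` Aut_over Y p \<subseteq> ?F"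
  proof
    fix u assume "u \<in> (\<lambda>\<phi>. \<phi> y) ` Aut_over Y p"
    then obtain \<phi> where \<phi>: "\<phi> \<in> Aut_over Y p" "u = \<phi> y" by blast
    then show "u \<in> ?F"
      using y(1) sbc_mem[OF Aut_over_sbc[OF \<phi>(1)] y(1)] by (simp add: Aut_over_def)
  qed
  ultimately have "(\<lambda>\<phi>. \<phi> y) ` Aut_over Y p = ?F"
    by (intro card_subset_eq[OF d(3)[OF py]])
  moreover have "y' \<in> ?F" using y by simp
  ultimately have "y' \<in> (\<lambda>\<phi>. \<phi> y) ` Aut_over Y p" by simp
  then show ?thesis by (rule imageE) (rule that, simp_all)
qed

section \<open>Descent along a factor map and the correspondence of inclusions\<close>

text \<open>A factor map out of a compact shift space is closed, hence a quotient map; so continuity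
  of \<open>g\<close> follows from that of \<open>g \<circ> a\<close>, which equals \<open>b\<close>
  on \<open>Y\<close>.\<close>

lemma sbc_descends:
  assumes Y: "shift_space Y" and a: "factor_map Y Z a" and b: "sliding_block_code Y W b"
    and fib: "\<And>y y'. y \<in> Y \<Longrightarrow> y' \<in> Y \<Longrightarrow> a y = a y' \<Longrightarrow> b y = b y'"
  obtains g where "sliding_block_code Z W g" "\<And>y. y \<in> Y \<Longrightarrow> g (a y) = b y"
proof -
  have sa: "sliding_block_code Y Z a" and aY: "a ` Y = Z" using a by (auto simp: factor_map_def)
  \<comment> \<open>The chosen preimage of \<open>z\<close> is arbitrary; by \<open>fib\<close> the
    value of \<open>b\<close> does not depend on it.\<close>
  define g where "g = (\<lambda>z. b (inv_into Y a z))"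
  have g: "g (a y) = b y" if "y \<in> Y" for y
    unfolding g_def using that by (intro fib) (auto simp: inv_into_into f_inv_into_f)
  have "quotient_map (shift_topology Y) (shift_topology Z) a"
    using sa aY sbc_closed_map[OF Y sa]
    by (intro continuous_closed_imp_quotient_map) (auto simp: sliding_block_code_def)
  moreover have "continuous_map (shift_topology Y) (shift_topology W) (g \<circ> a)"
    using b g by (auto simp: sliding_block_code_def intro: continuous_map_eq)
  ultimately have "continuous_map (shift_topology Z) (shift_topology W) g"
    by (rule continuous_compose_quotient_map)
  moreover have "g (shift z) = shift (g z)" if "z \<in> Z" for z
  proof -
    obtain y where y: "y \<in> Y" "z = a y" using \<open>z \<in> Z\<close> aY by blast
    have sy: "shift y \<in> Y" using shift_by_mem[OF Y y(1)] by (simp add: shift_eq_shift_by)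
    have "g (shift z) = g (a (shift y))"
      using sa y by (simp add: sliding_block_code_def)
    then show ?thesis
      using b y g sy by (simp add: sliding_block_code_def)
  qed
  ultimately show ?thesis
    using that g unfolding sliding_block_code_def by blast
qed

theorem theorem4p5:
  fixes X :: "(int \<Rightarrow> 'a::finite) set"
    and Y :: "(int \<Rightarrow> 'b::finite) set"
    and Z1 :: "(int \<Rightarrow> 'c::finite) set"
    and Z2 :: "(int \<Rightarrow> 'd::finite) set"
    and p :: "(int \<Rightarrow> 'b) \<Rightarrow> (int \<Rightarrow> 'a)"
    and \<alpha>1 :: "(int \<Rightarrow> 'b) \<Rightarrow> (int \<Rightarrow> 'c)"
    and \<beta>1 :: "(int \<Rightarrow> 'c) \<Rightarrow> (int \<Rightarrow> 'a)"
    and \<alpha>2 :: "(int \<Rightarrow> 'b) \<Rightarrow> (int \<Rightarrow> 'd)"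
    and \<beta>2 :: "(int \<Rightarrow> 'd) \<Rightarrow> (int \<Rightarrow> 'a)"
  assumes "irreducible_sft X"
    and "irreducible_sft Y"
    and "galois_factor Y X p"
    and "unramified_intermediate_factor Y X p Z1 \<alpha>1 \<beta>1"
    and "unramified_intermediate_factor Y X p Z2 \<alpha>2 \<beta>2"
  shows "Aut_over Y \<alpha>1 \<subseteq> Aut_over Y \<alpha>2 \<longleftrightarrow>
    (\<exists>\<gamma>. unramified Z1 Z2 \<gamma> \<and> unramified_intermediate_factor Y Z2 \<alpha>2 Z1 \<alpha>1 \<gamma>)"
proof
  assume H: "Aut_over Y \<alpha>1 \<subseteq> Aut_over Y \<alpha>2"
  have X: "shift_space X" "irreducible_shift X"
    and Y: "shift_space Y" "irreducible_shift Y"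
    using assms(1,2) by (auto simp: irreducible_sft_def sft_def)
  have Z1: "irreducible_sft Z1" and a1: "unramified Y Z1 \<alpha>1" and b1: "sliding_block_code Z1 X \<beta>1"
    and eq1: "\<And>y. y \<in> Y \<Longrightarrow> \<beta>1 (\<alpha>1 y) = p y"
    using assms(4) by (auto simp: unramified_intermediate_factor_def)
  have a2: "unramified Y Z2 \<alpha>2"
    using assms(5) by (simp add: unramified_intermediate_factor_def)
  have unr_p: "unramified Y X p" using assms(3) by (simp add: galois_factor_def)
  \<comment> \<open>This is what allows unique lifting to be applied to lifts through
    \<open>\<beta>1\<close>.\<close>
  have unr_b1: "unramified Z1 X \<beta>1"
    by (rule unramified_right_factor[OF a1 unr_p b1 eq1])
  have fibres: "\<alpha>2 y = \<alpha>2 y'" if y: "y \<in> Y" "y' \<in> Y" "\<alpha>1 y = \<alpha>1 y'" for y y'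
  proof -
    have "p y = p y'" using y eq1 by metis
    then obtain \<phi> where \<phi>: "\<phi> \<in> Aut_over Y p" "\<phi> y = y'"
      using galois_transitive[OF X assms(2,3) y(1,2)] by blast
    \<comment> \<open>Both \<open>\<alpha>1\<close> and its composite with \<open>\<phi>\<close> are
      lifts of \<open>p\<close> through \<open>\<beta>1\<close>, and they agree at \<open>y\<close>;
      hence they agree on all of \<open>Y\<close>.\<close>
    have "\<alpha>1 (\<phi> u) = \<alpha>1 u" if u: "u \<in> Y" for u
    proof (rule unramified_unique_lifting[OF Y _ X unr_b1 _ _ _ y(1) _ u])
      show "sft Z1" using Z1 by (simp add: irreducible_sft_def)
      show "sliding_block_code Y Z1 (\<lambda>u. \<alpha>1 (\<phi> u))"
        by (rule sbc_comp[OF Aut_over_sbc[OF \<phi>(1)] unramified_sbc[OF a1]])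
      show "sliding_block_code Y Z1 \<alpha>1" by (rule unramified_sbc[OF a1])
      show "\<beta>1 (\<alpha>1 (\<phi> v)) = \<beta>1 (\<alpha>1 v)" if "v \<in> Y" for v
        using that \<phi>(1) eq1 sbc_mem[OF Aut_over_sbc[OF \<phi>(1)] that] by (simp add: Aut_over_def)
      show "\<alpha>1 (\<phi> y) = \<alpha>1 y" using \<phi>(2) y(3) by simp
    qed
    then have "\<phi> \<in> Aut_over Y \<alpha>1" using \<phi>(1) by (simp add: Aut_over_def)
    then have "\<phi> \<in> Aut_over Y \<alpha>2" using H by blast
    then show ?thesis using \<phi>(2) y(1) by (auto simp: Aut_over_def)
  qed
  have "factor_map Y Z1 \<alpha>1" using a1 by (simp add: unramified_def)
  then obtain \<gamma> where \<gamma>: "sliding_block_code Z1 Z2 \<gamma>" "\<And>y. y \<in> Y \<Longrightarrow> \<gamma> (\<alpha>1 y) = \<alpha>2 y"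
    using sbc_descends[OF Y(1) _ unramified_sbc[OF a2], of Z1 \<alpha>1] fibres by blast
  have "unramified Z1 Z2 \<gamma>"
    by (rule unramified_right_factor[OF a1 a2 \<gamma>])
  then show "\<exists>\<gamma>. unramified Z1 Z2 \<gamma> \<and> unramified_intermediate_factor Y Z2 \<alpha>2 Z1 \<alpha>1 \<gamma>"
    using Z1 a1 \<gamma> by (auto simp: unramified_intermediate_factor_def)
next
  assume "\<exists>\<gamma>. unramified Z1 Z2 \<gamma> \<and> unramified_intermediate_factor Y Z2 \<alpha>2 Z1 \<alpha>1 \<gamma>"
  then obtain \<gamma> where \<gamma>: "\<And>y. y \<in> Y \<Longrightarrow> \<gamma> (\<alpha>1 y) = \<alpha>2 y"
    unfolding unramified_intermediate_factor_def by blast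
  show "Aut_over Y \<alpha>1 \<subseteq> Aut_over Y \<alpha>2"
  proof
    fix \<phi> assume \<phi>: "\<phi> \<in> Aut_over Y \<alpha>1"
    have "\<alpha>2 (\<phi> y) = \<alpha>2 y" if "y \<in> Y" for y
      \<comment> \<open>Since \<open>\<alpha>2\<close> factors through \<open>\<alpha>1\<close>, a
        map that preserves \<open>\<alpha>1\<close> preserves \<open>\<alpha>2\<close>.\<close>
      using \<gamma>[OF sbc_mem[OF Aut_over_sbc[OF \<phi>] that]] \<gamma>[OF that] \<phi> that
      by (simp add: Aut_over_def)
    then show "\<phi> \<in> Aut_over Y \<alpha>2" using \<phi> by (simp add: Aut_over_def)
  qed
qed

end
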